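(* The equation $x'=A_3(t)x^{n_3}+A_2(t)x^{n_2}+A_1(t)x^{n_1}$ has only finitely many nonconstant rational solutions $x\in\Bbbk(t)$.
   Context: $\Bbbk\in\{\mathbb{R},\mathbb{C}\}$; $n_1,n_2,n_3$ are natural numbers with $1<n_1<n_2<n_3$; $A_1,A_2,A_3\in\Bbbk[t]$ are nonzero polynomials. A rational function $x\in\Bbbk(t)$ is a solution if the differential equation holds as an identity in $\Bbbk(t)$. *)

theory Defs
  imports Complex_Main "HOL-Computational_Algebra.Computational_Algebra"
begin

text \<open>
  The field \<open>k(t)\<close> of rational functions is the fraction field \<open>'a poly fract\<close> of the polynomial
  ring, so equality of rational functions is equality in the field, not equality of values on
  some set of points. The polynomial ring embeds by the library's \<open>to_fract\<close>.
\<close>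

text \<open>
  The usual derivation on \<open>k(t)\<close>, by the quotient rule \<open>(p / q)' = (p' q - p q') / q\<^sup>2\<close>. The
  description is well defined: \<open>fract_deriv_Fract\<close> below gives the rule for every representation
  \<open>p / q\<close>.
\<close>

definition fract_deriv :: "'a::field poly fract \<Rightarrow> 'a poly fract"
  where "fract_deriv x = (THE y. \<exists>p q. q \<noteq> 0 \<and> x = Fraction_Field.Fract p q
    \<and> y = Fraction_Field.Fract (pderiv p * q - p * pderiv q) (q\<^sup>2))"

lemma quotient_rule_cong:
  fixes p q r s :: "'a::field poly"
  assumes q: "q \<noteq> 0" and s: "s \<noteq> 0"
    and "Fraction_Field.Fract p q = Fraction_Field.Fract r s"
  shows "Fraction_Field.Fract (pderiv p * q - p * pderiv q) (q\<^sup>2)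
    = Fraction_Field.Fract (pderiv r * s - r * pderiv s) (s\<^sup>2)"
proof -
  have eq: "p * s = r * q"
    using assms by (simp add: eq_fract)
  have d: "pderiv p * s + p * pderiv s = pderiv r * q + r * pderiv q"
    using arg_cong[OF eq, of pderiv] by (simp add: pderiv_mult algebra_simps)
  have "(pderiv p * q - p * pderiv q) * s\<^sup>2 - (pderiv r * s - r * pderiv s) * q\<^sup>2
      = q * s * ((pderiv p * s + p * pderiv s) - (pderiv r * q + r * pderiv q))
        - (p * s - r * q) * (s * pderiv q + q * pderiv s)"
    by (simp add: algebra_simps power2_eq_square)
  also have "\<dots> = 0" using d eq by simp
  finally show ?thesis using q s by (simp add: eq_fract)
qed

lemma fract_deriv_Fract:
  assumes "q \<noteq> 0"
  shows "fract_deriv (Fraction_Field.Fract p q)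
    = Fraction_Field.Fract (pderiv p * q - p * pderiv q) (q\<^sup>2)"
  unfolding fract_deriv_def
proof (rule the_equality)
  show "\<exists>p' q'. q' \<noteq> 0 \<and> Fraction_Field.Fract p q = Fraction_Field.Fract p' q' \<and>
      Fraction_Field.Fract (pderiv p * q - p * pderiv q) (q\<^sup>2)
      = Fraction_Field.Fract (pderiv p' * q' - p' * pderiv q') (q'\<^sup>2)"
    using assms by blast
qed (metis quotient_rule_cong assms)

lemma fract_deriv_to_fract: "fract_deriv (to_fract p) = to_fract (pderiv p)"
  by (simp add: to_fract_def fract_deriv_Fract)

lemma fract_deriv_add: "fract_deriv (x + y) = fract_deriv x + fract_deriv y"
  by (cases x, cases y)
    (simp add: fract_deriv_Fract eq_fract pderiv_add pderiv_mult algebra_simps power2_eq_square)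

lemma fract_deriv_mult: "fract_deriv (x * y) = fract_deriv x * y + x * fract_deriv y"
  by (cases x, cases y)
    (simp add: fract_deriv_Fract eq_fract pderiv_mult algebra_simps power2_eq_square)

definition nonconstant_fract :: "'a::field poly fract \<Rightarrow> bool"
  where "nonconstant_fract x \<longleftrightarrow> (\<nexists>c. x = to_fract [:c:])"

end

theory Submission
  imports Defs "HOL-Computational_Algebra.Field_as_Ring"
begin

text \<open>
  Write a rational solution as \<open>x = p / q\<close> in lowest terms. After clearing denominators every term
  other than \<open>p' q ^ (n3 - 1)\<close> carries a factor \<open>p\<close>, so \<open>p\<close> divides \<open>p'\<close> and \<open>p\<close> is a
  constant \<open>c\<close>. The equation then shows that \<open>q\<close> divides \<open>A3\<close>, which leaves finitely many monic
  \<open>q\<close>. For fixed \<open>q\<close>, comparing one coefficient at which \<open>A3\<close> does not vanish gives a polynomial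
  equation for \<open>c\<close> of degree \<open>n3\<close>, so finitely many \<open>c\<close>.
\<close>

text \<open>Such a divisor is determined by its prime factors, which form a submultiset of those of
  \<open>a\<close>. Bounding only support and size suffices: these multisets come from lists of
  bounded length over a finite set.\<close>

lemma finite_normalized_divisors:
  fixes a :: "'a::factorial_semiring"
  assumes "a \<noteq> 0"
  shows "finite {d. d dvd a \<and> normalize d = d}"
proof -
  define F where "F = prime_factorization a"
  have "{d. d dvd a \<and> normalize d = d} \<subseteq>
      (\<lambda>M. normalize (prod_mset M)) ` {M. set_mset M \<subseteq> set_mset F \<and> size M \<le> size F}"
  proof
    fix d assume "d \<in> {d. d dvd a \<and> normalize d = d}"
    hence d: "d dvd a" "normalize d = d" by auto
    with assms have "d \<noteq> 0" by auto
    with d assms have "prime_factorization d \<subseteq># F"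
      by (simp add: F_def prime_factorization_subset_iff_dvd)
    \<comment> \<open>In a general factorial semiring the product of the prime factors need not
      itself be normalized, hence the outer \<open>normalize\<close>.\<close>
    moreover have "d = normalize (prod_mset (prime_factorization d))"
      using \<open>d \<noteq> 0\<close> d by (simp add: prod_mset_prime_factorization_weak)
    ultimately show "d \<in> (\<lambda>M. normalize (prod_mset M)) `
        {M. set_mset M \<subseteq> set_mset F \<and> size M \<le> size F}"
      using set_mset_mono size_mset_mono by blast
  qed
  moreover have "finite {M. set_mset M \<subseteq> set_mset F \<and> size M \<le> size F}"
  proof (rule finite_subset)
    show "{M. set_mset M \<subseteq> set_mset F \<and> size M \<le> size F}
        \<subseteq> mset ` {xs. set xs \<subseteq> set_mset F \<and> length xs \<le> size F}"
    proof
      fix M assume "M \<in> {M. set_mset M \<subseteq> set_mset F \<and> size M \<le> size F}"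
      moreover obtain xs where "M = mset xs" by (metis ex_mset)
      ultimately show "M \<in> mset ` {xs. set xs \<subseteq> set_mset F \<and> length xs \<le> size F}" by auto
    qed
    show "finite (mset ` {xs. set xs \<subseteq> set_mset F \<and> length xs \<le> size F})"
      by (simp add: finite_lists_length_le)
  qed
  ultimately show ?thesis by (rule finite_subset[OF _ finite_imageI])
qed

text \<open>Multiplication by the nonzero \<open>q ^ n3\<close> clears all denominators; the
  quotient rule uses up \<open>q ^ 2\<close>, which leaves \<open>q ^ (n3 - 2)\<close>.\<close>

lemma Fract_solution_iff:
  fixes p q A1 A2 A3 :: "'a::field poly"
  assumes n: "1 < n1" "n1 < n2" "n2 < n3" and q: "q \<noteq> 0"
  shows "fract_deriv (Fraction_Field.Fract p q) = to_fract A3 * Fraction_Field.Fract p q ^ n3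
      + to_fract A2 * Fraction_Field.Fract p q ^ n2 + to_fract A1 * Fraction_Field.Fract p q ^ n1
    \<longleftrightarrow> (pderiv p * q - p * pderiv q) * q ^ (n3 - 2)
      = A3 * p ^ n3 + A2 * p ^ n2 * q ^ (n3 - n2) + A1 * p ^ n1 * q ^ (n3 - n1)"
    (is "?L \<longleftrightarrow> ?R")
proof -
  have pw: "to_fract (u ^ k) = to_fract u ^ k" for u :: "'a poly" and k
    by (induction k) auto
  define P Q where "P = to_fract p" and "Q = to_fract q"
  have Q: "Q \<noteq> 0" using q by (simp add: Q_def)
  \<comment> \<open>Used for \<open>k\<close> equal to 2, \<open>n2\<close> and \<open>n1\<close>,
    all at most \<open>n3\<close>, so the subtraction is never truncated.\<close>
  have s: "Q ^ n3 = Q ^ k * Q ^ (n3 - k)" if "k \<le> n3" for k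
    using that by (simp flip: power_add)
  define W where "W = to_fract (pderiv p * q - p * pderiv q)"
  have "?L \<longleftrightarrow> W / Q ^ 2 = to_fract A3 * (P / Q) ^ n3 + to_fract A2 * (P / Q) ^ n2
      + to_fract A1 * (P / Q) ^ n1"
    by (simp only: fract_deriv_Fract[OF q]) (simp only: Fract_conv_to_fract pw W_def P_def Q_def)
  also have "\<dots> \<longleftrightarrow> W / Q ^ 2 * Q ^ n3 = (to_fract A3 * (P / Q) ^ n3 + to_fract A2 * (P / Q) ^ n2
      + to_fract A1 * (P / Q) ^ n1) * Q ^ n3"
    by (rule mult_right_cancel[symmetric]) (simp add: Q)
  also have "W / Q ^ 2 * Q ^ n3 = W * Q ^ (n3 - 2)"
    using s[of 2] n Q by simp
  also have "(to_fract A3 * (P / Q) ^ n3 + to_fract A2 * (P / Q) ^ n2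
      + to_fract A1 * (P / Q) ^ n1) * Q ^ n3 = to_fract A3 * ((P / Q) ^ n3 * Q ^ n3)
      + to_fract A2 * ((P / Q) ^ n2 * Q ^ n3) + to_fract A1 * ((P / Q) ^ n1 * Q ^ n3)"
    by (simp add: algebra_simps)
  also have "(P / Q) ^ n3 * Q ^ n3 = P ^ n3"
    using Q by (simp add: power_divide)
  also have "(P / Q) ^ n2 * Q ^ n3 = P ^ n2 * Q ^ (n3 - n2)"
    using s[of n2] n Q by (simp add: power_divide)
  also have "(P / Q) ^ n1 * Q ^ n3 = P ^ n1 * Q ^ (n3 - n1)"
    using s[of n1] n Q by (simp add: power_divide)
  also have "W * Q ^ (n3 - 2) = to_fract A3 * P ^ n3 + to_fract A2 * (P ^ n2 * Q ^ (n3 - n2))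
      + to_fract A1 * (P ^ n1 * Q ^ (n3 - n1)) \<longleftrightarrow>
    to_fract ((pderiv p * q - p * pderiv q) * q ^ (n3 - 2))
      = to_fract (A3 * p ^ n3 + A2 * p ^ n2 * q ^ (n3 - n2) + A1 * p ^ n1 * q ^ (n3 - n1))"
    unfolding W_def P_def Q_def by (simp add: pw mult.assoc del: to_fract_eq_iff)
  finally show ?thesis by (simp only: to_fract_eq_iff)
qed

lemma degree_numerator_solution:
  fixes p q A1 A2 A3 :: "'a::{field_char_0,field_gcd} poly"
  assumes n: "1 < n1" "n1 < n2" "n2 < n3" and cop: "coprime p q"
    and eq: "(pderiv p * q - p * pderiv q) * q ^ (n3 - 2)
      = A3 * p ^ n3 + A2 * p ^ n2 * q ^ (n3 - n2) + A1 * p ^ n1 * q ^ (n3 - n1)"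
  shows "degree p = 0"
proof -
  have "p dvd A3 * p ^ n3 + A2 * p ^ n2 * q ^ (n3 - n2) + A1 * p ^ n1 * q ^ (n3 - n1)"
    using n by (intro dvd_add dvd_mult dvd_mult2 dvd_power) auto
  hence "p dvd (pderiv p * q - p * pderiv q) * q ^ (n3 - 2)" by (simp only: eq)
  moreover have "coprime p (q ^ (n3 - 2))" using cop by simp
  ultimately have "p dvd pderiv p * q - p * pderiv q"
    by (simp add: coprime_dvd_mult_left_iff)
  \<comment> \<open>Adding back a multiple of \<open>p\<close> isolates \<open>pderiv p * q\<close>,
    from which coprimality removes \<open>q\<close>. In characteristic zero a nonconstant polynomial
    cannot divide its derivative, which is nonzero of smaller degree.\<close>
  hence "p dvd pderiv p * q - p * pderiv q + p * pderiv q" by (rule dvd_add) simp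
  hence "p dvd pderiv p" using cop by (simp add: coprime_dvd_mult_left_iff)
  thus ?thesis using not_dvd_pderiv by blast
qed

text \<open>The exponents \<open>n3 - 2\<close>, \<open>n3 - n2\<close> and \<open>n3 - n1\<close>
  are positive, so modulo \<open>q\<close> only \<open>A3 * [:c:] ^ n3\<close> survives, and
  \<open>[:c:] ^ n3\<close> is a unit.\<close>

lemma denominator_solution_dvd:
  fixes q A1 A2 A3 :: "'a::field poly"
  assumes n: "1 < n1" "n1 < n2" "n2 < n3" and c: "c \<noteq> 0"
    and eq: "(pderiv [:c:] * q - [:c:] * pderiv q) * q ^ (n3 - 2)
      = A3 * [:c:] ^ n3 + A2 * [:c:] ^ n2 * q ^ (n3 - n2) + A1 * [:c:] ^ n1 * q ^ (n3 - n1)"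
  shows "q dvd A3"
proof -
  have "A3 * [:c:] ^ n3 = (pderiv [:c:] * q - [:c:] * pderiv q) * q ^ (n3 - 2)
      - A2 * [:c:] ^ n2 * q ^ (n3 - n2) - A1 * [:c:] ^ n1 * q ^ (n3 - n1)"
    unfolding eq by simp
  moreover have "q dvd \<dots>"
    using n by (intro dvd_diff dvd_mult dvd_power) auto
  ultimately have "q dvd A3 * [:c:] ^ n3" by simp
  hence "q dvd smult (c ^ n3) A3" by (simp add: poly_const_pow mult.commute)
  thus ?thesis using c by (simp add: dvd_smult_iff)
qed

lemma finite_constant_numerators:
  fixes q A1 A2 A3 :: "'a::field poly"
  assumes n: "1 < n1" "n1 < n2" "n2 < n3" and A3: "A3 \<noteq> 0"
  shows "finite {c. (pderiv [:c:] * q - [:c:] * pderiv q) * q ^ (n3 - 2)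
      = A3 * [:c:] ^ n3 + A2 * [:c:] ^ n2 * q ^ (n3 - n2) + A1 * [:c:] ^ n1 * q ^ (n3 - n1)}"
    (is "finite {c. ?E c}")
proof -
  \<comment> \<open>\<open>H\<close> collects the coefficients of index \<open>i\<close> as a
    polynomial in the unknown \<open>c\<close>. Taking \<open>i\<close> to be the degree makes the
    coefficient of \<open>A3\<close> nonzero, and the other powers of \<open>c\<close> lie below
    \<open>n3\<close>.\<close>
  define i where "i = degree A3"
  define H where "H = monom (coeff A3 i) n3 + monom (coeff (A2 * q ^ (n3 - n2)) i) n2
    + monom (coeff (A1 * q ^ (n3 - n1)) i) n1 + monom (coeff (pderiv q * q ^ (n3 - 2)) i) 1"
  have "coeff H n3 = coeff A3 i" using n by (simp add: H_def)
  with A3 have "H \<noteq> 0" by (auto simp: i_def)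
  moreover have "poly H c = 0" if "?E c" for c
  proof -
    from that have "- smult c (pderiv q * q ^ (n3 - 2)) = smult (c ^ n3) A3
        + smult (c ^ n2) (A2 * q ^ (n3 - n2)) + smult (c ^ n1) (A1 * q ^ (n3 - n1))"
      by (simp add: poly_const_pow mult.commute pderiv_pCons)
    hence "smult (c ^ n3) A3 + smult (c ^ n2) (A2 * q ^ (n3 - n2))
        + smult (c ^ n1) (A1 * q ^ (n3 - n1)) + smult c (pderiv q * q ^ (n3 - 2)) = 0"
      by (metis neg_eq_iff_add_eq_0 add.commute)
    from arg_cong[OF this, of "\<lambda>r. coeff r i"] show ?thesis
      by (simp add: H_def poly_monom mult.commute)
  qed
  ultimately show ?thesis
    using poly_roots_finite[of H] by (auto intro: finite_subset[rotated])
qed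

lemma finite_nonconstant_solutions:
  fixes A1 A2 A3 :: "'a::{field_char_0,field_gcd} poly"
  assumes n: "1 < n1" "n1 < n2" "n2 < n3" and A3: "A3 \<noteq> 0"
  shows "finite {x. nonconstant_fract x \<and>
    fract_deriv x = to_fract A3 * x ^ n3 + to_fract A2 * x ^ n2 + to_fract A1 * x ^ n1}"
proof -
  define E where "E = (\<lambda>p q. (pderiv p * q - p * pderiv q) * q ^ (n3 - 2)
    = A3 * p ^ n3 + A2 * p ^ n2 * q ^ (n3 - n2) + A1 * p ^ n1 * q ^ (n3 - n1))"
  \<comment> \<open>A dependent sum, since the admissible \<open>c\<close> vary with
    \<open>q\<close>. Normalization selects one denominator from each class of associates.\<close>
  define S where "S = (SIGMA q:{q. q dvd A3 \<and> normalize q = q}. {c. E [:c:] q})"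
  have "finite S"
    unfolding S_def E_def
    by (intro finite_SigmaI finite_normalized_divisors finite_constant_numerators n A3)
  moreover have "x \<in> (\<lambda>(q, c). Fraction_Field.Fract [:c:] q) ` S"
    if nonconst: "nonconstant_fract x"
      and sol: "fract_deriv x = to_fract A3 * x ^ n3 + to_fract A2 * x ^ n2 + to_fract A1 * x ^ n1"
    for x
  proof -
    obtain p q where pq: "quot_of_fract x = (p, q)" by fastforce
    have x: "x = Fraction_Field.Fract p q" and q: "q \<noteq> 0" "normalize q = q"
      and cop: "coprime p q"
      using pq Fract_quot_of_fract[of x] snd_quot_of_fract_nonzero[of x]
        normalize_snd_quot_of_fract[of x] coprime_quot_of_fract[of x] by simp_all
    have E: "E p q"
      using sol unfolding E_def x Fract_solution_iff[OF n q(1)] .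
    hence "degree p = 0" unfolding E_def by (rule degree_numerator_solution[OF n cop])
    then obtain c where c: "p = [:c:]" by (rule degree_eq_zeroE)
    \<comment> \<open>Nonconstancy excludes the zero solution, so \<open>c\<close> is invertible, as
      the divisibility argument requires.\<close>
    have "c \<noteq> 0"
    proof
      assume "c = 0"
      hence "x = to_fract [:0:]" by (simp add: x c Fract_conv_to_fract)
      with nonconst show False unfolding nonconstant_fract_def by blast
    qed
    hence "q dvd A3" using E unfolding E_def c by (rule denominator_solution_dvd[OF n])
    with q E show ?thesis by (auto simp: S_def x c intro!: image_eqI[of _ _ "(q, c)"])
  qed
  ultimately show ?thesis by (elim finite_subset[OF _ finite_imageI, rotated]) blast
qed

theorem corollary2p2:
  fixes n1 n2 n3 :: nat
  assumes "1 < n1" "n1 < n2" "n2 < n3"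
  shows "(\<forall>A1 A2 A3 :: real poly. A1 \<noteq> 0 \<and> A2 \<noteq> 0 \<and> A3 \<noteq> 0 \<longrightarrow>
            finite {x :: real poly fract. nonconstant_fract x \<and>
              fract_deriv x = to_fract A3 * x ^ n3 + to_fract A2 * x ^ n2 + to_fract A1 * x ^ n1})
       \<and> (\<forall>A1 A2 A3 :: complex poly. A1 \<noteq> 0 \<and> A2 \<noteq> 0 \<and> A3 \<noteq> 0 \<longrightarrow>
            finite {x :: complex poly fract. nonconstant_fract x \<and>
              fract_deriv x = to_fract A3 * x ^ n3 + to_fract A2 * x ^ n2 + to_fract A1 * x ^ n1})"
  by (intro conjI allI impI finite_nonconstant_solutions[OF assms]) simp_all

end
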